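(* Let $q\ge 2$ and let $\alpha$ be a fixed probability vector of length $q$. On the set of $q\times q$ stochastic matrices $M$ with all entries strictly positive that satisfy $\alpha M=\alpha$, the function $M\mapsto c(M)=\sup_{p}\frac{L(pM^{\mathrm{rev}})}{L(p)}$ (defined in the context) is convex. Consequently, for each $\alpha$ and each fixed degree $d\in\{1,2,\dots\}$, the set $\{M:\ \alpha M=\alpha,\ d\,c(M)<1\}$ of such matrices is convex.
   Context: If a strictly positive stochastic matrix $M$ satisfies $\alpha M=\alpha$, i.e. $\sum_i\alpha(i)M(i,j)=\alpha(j)$, then all $\alpha(i)>0$. $P$ is the simplex of probability vectors of length $q$; $S(p|\alpha)=\sum_i p(i)\log\frac{p(i)}{\alpha(i)}$ is relative entropy; $L(p)=S(p|\alpha)+S(\alpha|p)=\sum_{i=1}^q(p(i)-\alpha(i))\log\frac{p(i)}{\alpha(i)}\in[0,\infty]$, with $L(p)=+\infty$ if some $p(i)=0$. The reversed transition matrix is $M^{\mathrm{rev}}(i,j)=\frac{\alpha(j)M(j,i)}{\alpha(i)}$, and $(pM^{\mathrm{rev}})(j)=\sum_i p(i)M^{\mathrm{rev}}(i,j)$. Then $c(M)=\sup_{p\in P,\,p\ne\alpha}\frac{L(pM^{\mathrm{rev}})}{L(p)}$, where the ratio is read as $0$ when $L(p)=+\infty$ (the numerator is always finite because $pM^{\mathrm{rev}}$ has positive entries). *)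

theory Defs
  imports "HOL-Analysis.Analysis"
begin

definition prob_simplex :: "(real ^ 'q::finite) set" where
  "prob_simplex = {p. (\<forall>i. 0 \<le> p $ i) \<and> (\<Sum>i\<in>UNIV. p $ i) = 1}"

text \<open>Summand \<open>x log (x / y)\<close> of relative entropy for \<open>x, y \<ge> 0\<close>, with the usual conventions
  \<open>0 log (0 / y) = 0\<close> and \<open>x log (x / 0) = \<infinity>\<close> for \<open>x > 0\<close>.\<close>

definition rel_entropy_term :: "real \<Rightarrow> real \<Rightarrow> ereal" where
  "rel_entropy_term x y = (if x = 0 then 0 else if y = 0 then \<infinity> else ereal (x * ln (x / y)))"

definition rel_entropy :: "real ^ 'q::finite \<Rightarrow> real ^ 'q \<Rightarrow> ereal" where
  "rel_entropy p a = (\<Sum>i\<in>UNIV. rel_entropy_term (p $ i) (a $ i))"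

definition sym_entropy :: "real ^ 'q::finite \<Rightarrow> real ^ 'q \<Rightarrow> ereal" where
  "sym_entropy a p = rel_entropy p a + rel_entropy a p"

definition rev_matrix :: "real ^ 'q::finite \<Rightarrow> real ^ 'q ^ 'q \<Rightarrow> real ^ 'q ^ 'q" where
  "rev_matrix a M = (\<chi> i j. a $ j * M $ j $ i / a $ i)"

text \<open>The value is an extended real, so that the supremum is unconditionally meaningful.\<close>

definition contraction_coeff :: "real ^ 'q::finite \<Rightarrow> real ^ 'q ^ 'q \<Rightarrow> ereal" where
  "contraction_coeff a M =
    (SUP p\<in>prob_simplex - {a}.
      if sym_entropy a p = \<infinity> then 0
      else sym_entropy a (p v* rev_matrix a M) / sym_entropy a p)"

definition pos_stochastic_matrices :: "real ^ 'q::finite \<Rightarrow> (real ^ 'q ^ 'q) set" where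
  "pos_stochastic_matrices a =
    {M. (\<forall>i. M $ i \<in> prob_simplex) \<and> (\<forall>i j. 0 < M $ i $ j) \<and> a v* M = a}"

lemma sym_entropy_pos:
  fixes a p :: "real ^ 'q::finite"
  assumes a: "\<And>i. 0 < a $ i" and p: "\<And>i. 0 < p $ i"
  shows "sym_entropy a p = ereal (\<Sum>i\<in>UNIV. (p $ i - a $ i) * ln (p $ i / a $ i))"
proof -
  have nz: "a $ i \<noteq> 0" "p $ i \<noteq> 0" for i
    using a[of i] p[of i] by auto
  have "p $ i * ln (p $ i / a $ i) + a $ i * ln (a $ i / p $ i)
      = (p $ i - a $ i) * ln (p $ i / a $ i)" for i
    using a[of i] p[of i] by (simp add: ln_div algebra_simps)
  then show ?thesis
    by (simp add: sym_entropy_def rel_entropy_def rel_entropy_term_def nz flip: sum.distrib)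
qed

lemma sym_entropy_zero_entry:
  fixes a p :: "real ^ 'q::finite"
  assumes a: "\<And>i. 0 < a $ i" and i: "p $ i = 0"
  shows "sym_entropy a p = \<infinity>"
proof -
  have nz: "a $ j \<noteq> 0" for j
    using a[of j] by simp
  have "rel_entropy_term (a $ i) (p $ i) = \<infinity>"
    by (simp add: rel_entropy_term_def nz i)
  then have "rel_entropy a p = \<infinity>"
    unfolding rel_entropy_def by (subst sum_Pinfty) auto
  then show ?thesis
    by (simp add: sym_entropy_def)
qed

lemma pos_stochastic_matrices_stationary_pos:
  fixes a :: "real ^ 'q::finite"
  assumes a: "a \<in> prob_simplex" and M: "M \<in> pos_stochastic_matrices a"
  shows "0 < a $ j"
proof -
  have nn: "0 \<le> a $ i" and s: "(\<Sum>i\<in>UNIV. a $ i) = 1" for i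
    using a by (auto simp: prob_simplex_def)
  have Mp: "0 < M $ i $ k" for i k
    using M by (auto simp: pos_stochastic_matrices_def)
  obtain k where "a $ k \<noteq> 0"
    using s by (metis sum.neutral zero_neq_one)
  then have "0 < a $ k"
    using nn[of k] by simp
  then have "0 < (\<Sum>i\<in>UNIV. M $ i $ j * a $ i)"
    by (intro sum_pos2[where i = k]) (auto simp: nn Mp less_imp_le)
  also have "\<dots> = (a v* M) $ j"
    by (simp add: vector_matrix_mult_def mult.commute)
  also have "a v* M = a"
    using M by (simp add: pos_stochastic_matrices_def)
  finally show ?thesis .
qed

end

theory Submission
  imports Defs
begin

text \<open>In the density coordinates \<open>x = p / \<alpha>\<close>, the step \<open>p \<mapsto> p M\<^sup>r\<^sup>e\<^sup>v\<close> becomes \<open>x \<mapsto> M x\<close>, which is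
  linear in \<open>M\<close>, and \<open>L(p)\<close> becomes the \<open>\<alpha>\<close>-average of \<open>\<phi>(x)\<close> with \<open>\<phi>(t) = (t - 1) ln t\<close> convex.
  Hence for every fixed \<open>p\<close> the ratio is convex in \<open>M\<close>. Jensen's inequality along the rows of \<open>M\<close>,
  together with stationarity, bounds it by 1, so the supremum over \<open>p\<close> is finite and convex.\<close>

section \<open>The function \<open>(t - 1) * ln t\<close> and its weighted average\<close>

definition jeffreys_fun :: "real \<Rightarrow> real" where
  "jeffreys_fun t = (t - 1) * ln t"

text \<open>The factors \<open>t - 1\<close> and \<open>ln t\<close> change sign together at
  1.\<close>

lemma jeffreys_fun_nonneg: "0 < t \<Longrightarrow> 0 \<le> jeffreys_fun t"
  by (cases "t \<ge> 1") (auto simp: jeffreys_fun_def intro: mult_nonneg_nonneg mult_nonpos_nonpos)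

lemma jeffreys_fun_eq_0_iff: "0 < t \<Longrightarrow> jeffreys_fun t = 0 \<longleftrightarrow> t = 1"
  by (auto simp: jeffreys_fun_def)

text \<open>Serves twice: for Jensen along a matrix row, and coordinatewise for the convexity of
  \<open>jeffreys_avg\<close>.\<close>

lemma convex_on_jeffreys_fun: "convex_on {0<..} jeffreys_fun"
proof (rule f''_ge0_imp_convex)
  fix t :: real assume "t \<in> {0<..}"
  then have t: "0 < t" by simp
  show "(jeffreys_fun has_real_derivative ln t + 1 - 1 / t) (at t)"
    unfolding jeffreys_fun_def using t
    by (auto intro!: derivative_eq_intros simp: field_simps)
  show "((\<lambda>t. ln t + 1 - 1 / t) has_real_derivative 1 / t + 1 / t\<^sup>2) (at t)"
    using t by (auto intro!: derivative_eq_intros simp: field_simps power2_eq_square)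
  show "0 \<le> 1 / t + 1 / t\<^sup>2"
    using t by simp
qed auto

definition jeffreys_avg :: "real ^ 'q::finite \<Rightarrow> real ^ 'q \<Rightarrow> real" where
  "jeffreys_avg a x = (\<Sum>i\<in>UNIV. a $ i * jeffreys_fun (x $ i))"

lemma sym_entropy_jeffreys_avg:
  fixes a p :: "real ^ 'q::finite"
  assumes a: "\<And>i. 0 < a $ i" and p: "\<And>i. 0 < p $ i"
  shows "sym_entropy a p = ereal (jeffreys_avg a (\<chi> i. p $ i / a $ i))"
proof -
  \<comment> \<open>Pulling out the weight \<open>a $ i\<close> leaves a function of the density
    \<open>p $ i / a $ i\<close> alone.\<close>
  have "(p $ i - a $ i) * ln (p $ i / a $ i) = a $ i * jeffreys_fun (p $ i / a $ i)" for i
    using a[of i] by (simp add: jeffreys_fun_def field_simps)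
  then show ?thesis
    by (simp add: sym_entropy_pos[OF a p] jeffreys_avg_def)
qed

lemma jeffreys_avg_nonneg:
  assumes "\<And>i. 0 < a $ i" and "\<And>i. 0 < x $ i"
  shows "0 \<le> jeffreys_avg a x"
  unfolding jeffreys_avg_def
  by (intro sum_nonneg mult_nonneg_nonneg less_imp_le[OF assms(1)] jeffreys_fun_nonneg assms(2))

text \<open>A vanishing sum of nonnegative terms vanishes termwise. This will keep the denominators
  L(p) nonzero for p different from \<alpha>.\<close>

lemma jeffreys_avg_eq_0:
  assumes a: "\<And>i. 0 < a $ i" and x: "\<And>i. 0 < x $ i" and 0: "jeffreys_avg a x = 0"
  shows "x $ i = 1"
proof -
  have "a $ i * jeffreys_fun (x $ i) = 0"
    using 0 less_imp_le[OF a] jeffreys_fun_nonneg[OF x] unfolding jeffreys_avg_def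
    by (subst (asm) sum_nonneg_eq_0_iff) auto
  then show ?thesis
    using a[of i] x[of i] by (simp add: jeffreys_fun_eq_0_iff)
qed

lemma convex_on_jeffreys_avg:
  fixes a :: "real ^ 'q::finite"
  assumes a: "\<And>i. 0 < a $ i"
  shows "convex_on {x. \<forall>i. 0 < x $ i} (jeffreys_avg a)"
proof (rule convex_onI)
  show "convex {x :: real ^ 'q. \<forall>i. 0 < x $ i}"
    using convex_real_interval(3)[of 0] by (simp add: convex_def greaterThan_iff)
next
  fix t :: real and x y :: "real ^ 'q"
  assume t: "0 < t" "t < 1" and x: "x \<in> {x. \<forall>i. 0 < x $ i}" and y: "y \<in> {x. \<forall>i. 0 < x $ i}"
  have "a $ i * jeffreys_fun ((1 - t) * x $ i + t * y $ i)
      \<le> a $ i * ((1 - t) * jeffreys_fun (x $ i) + t * jeffreys_fun (y $ i))" for i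
    using convex_onD[OF convex_on_jeffreys_fun, of t "x $ i" "y $ i"] t x y a[of i] by simp
  then show "jeffreys_avg a ((1 - t) *\<^sub>R x + t *\<^sub>R y) \<le> (1 - t) * jeffreys_avg a x + t * jeffreys_avg a y"
    unfolding jeffreys_avg_def
    by (simp add: sum_distrib_left flip: sum.distrib) (intro sum_mono, simp add: algebra_simps)
qed

section \<open>Matrices acting on densities, and the ratio at a fixed p\<close>

lemma matrix_vector_mult_pos:
  fixes M :: "real ^ 'n::finite ^ 'm::finite"
  assumes "\<And>i j. 0 < M $ i $ j" and "\<And>j. 0 < x $ j"
  shows "0 < (M *v x) $ i"
  by (auto simp: matrix_vector_mult_def intro!: sum_pos mult_pos_pos assms)

text \<open>Regroup each term p(i) \<alpha>(j) M(j,i) / \<alpha>(i): the transposition in the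
  reversed matrix turns its action on row vectors into the action of M on columns.\<close>

lemma rev_matrix_density:
  fixes a p :: "real ^ 'q::finite"
  assumes a: "\<And>i. 0 < a $ i"
  shows "(p v* rev_matrix a M) $ j = a $ j * (M *v (\<chi> i. p $ i / a $ i)) $ j"
  by (simp add: vector_matrix_mult_def matrix_vector_mult_def rev_matrix_def sum_distrib_left mult.commute
      mult.left_commute)

text \<open>The data-processing inequality for the symmetrised divergence.\<close>

lemma jeffreys_avg_matrix_vector_mult_le:
  fixes a :: "real ^ 'q::finite"
  assumes a: "\<And>i. 0 < a $ i" and M: "M \<in> pos_stochastic_matrices a" and x: "\<And>i. 0 < x $ i"
  shows "jeffreys_avg a (M *v x) \<le> jeffreys_avg a x"
proof -
  have Mp: "0 < M $ i $ j" and Ms: "(\<Sum>j\<in>UNIV. M $ i $ j) = 1" for i j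
    using M by (auto simp: pos_stochastic_matrices_def prob_simplex_def)
  have st: "(\<Sum>i\<in>UNIV. a $ i * M $ i $ j) = a $ j" for j
  proof -
    have "(a v* M) $ j = a $ j" using M by (simp add: pos_stochastic_matrices_def)
    then show ?thesis by (simp add: vector_matrix_mult_def mult.commute)
  qed
  \<comment> \<open>Row i of M is a probability vector and supplies the Jensen weights.\<close>
  have "jeffreys_fun (\<Sum>j\<in>UNIV. M $ i $ j *\<^sub>R x $ j) \<le> (\<Sum>j\<in>UNIV. M $ i $ j * jeffreys_fun (x $ j))" for i
    by (rule convex_on_sum[OF _ _ convex_on_jeffreys_fun]) (auto simp: Ms x less_imp_le[OF Mp])
  then have "jeffreys_avg a (M *v x) \<le> (\<Sum>i\<in>UNIV. a $ i * (\<Sum>j\<in>UNIV. M $ i $ j * jeffreys_fun (x $ j)))"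
    unfolding jeffreys_avg_def
    by (intro sum_mono mult_left_mono) (auto simp: matrix_vector_mult_def less_imp_le[OF a])
  \<comment> \<open>After the swap the inner sum over i collapses to \<open>a $ j\<close> by
    stationarity.\<close>
  also have "\<dots> = (\<Sum>j\<in>UNIV. \<Sum>i\<in>UNIV. a $ i * M $ i $ j * jeffreys_fun (x $ j))"
    by (subst sum.swap) (simp add: sum_distrib_left mult.assoc)
  also have "\<dots> = jeffreys_avg a x"
    by (simp add: jeffreys_avg_def st flip: sum_distrib_right)
  finally show ?thesis .
qed

text \<open>For positive \<alpha> and p in the simplex, a zero entry of p is exactly the case L(p) =
  \<infinity>, so testing for it allows real values throughout.\<close>

definition contraction_ratio :: "real ^ 'q::finite \<Rightarrow> real ^ 'q \<Rightarrow> real ^ 'q ^ 'q \<Rightarrow> real" where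
  "contraction_ratio a p M =
    (if \<exists>i. p $ i = 0 then 0
     else jeffreys_avg a (M *v (\<chi> i. p $ i / a $ i)) / jeffreys_avg a (\<chi> i. p $ i / a $ i))"

lemma jeffreys_avg_density_pos:
  fixes a p :: "real ^ 'q::finite"
  assumes a: "\<And>i. 0 < a $ i" and p: "\<And>i. 0 < p $ i" and "p \<noteq> a"
  shows "0 < jeffreys_avg a (\<chi> i. p $ i / a $ i)"
proof -
  have x: "0 < (\<chi> i. p $ i / a $ i) $ i" for i
    using a p by simp
  have "jeffreys_avg a (\<chi> i. p $ i / a $ i) \<noteq> 0"
  proof
    assume "jeffreys_avg a (\<chi> i. p $ i / a $ i) = 0"
    from jeffreys_avg_eq_0[OF a x this] have "p $ i = a $ i" for i
      using a[of i] by (simp add: field_simps)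
    with \<open>p \<noteq> a\<close> show False by (simp add: vec_eq_iff)
  qed
  with jeffreys_avg_nonneg[OF a x] show ?thesis by simp
qed

lemma contraction_coeff_SUP:
  fixes a :: "real ^ 'q::finite"
  assumes a: "\<And>i. 0 < a $ i" and M: "\<And>i j. 0 < M $ i $ j"
  shows "contraction_coeff a M = (SUP p\<in>prob_simplex - {a}. ereal (contraction_ratio a p M))"
  unfolding contraction_coeff_def
proof (rule SUP_cong[OF refl])
  fix p assume "p \<in> prob_simplex - {a}"
  then have nn: "0 \<le> p $ i" and ne: "p \<noteq> a" for i
    by (auto simp: prob_simplex_def)
  show "(if sym_entropy a p = \<infinity> then 0 else sym_entropy a (p v* rev_matrix a M) / sym_entropy a p)
      = ereal (contraction_ratio a p M)"
  proof (cases "\<exists>i. p $ i = 0")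
    case True
    then show ?thesis
      using sym_entropy_zero_entry[of a, OF a] by (auto simp: contraction_ratio_def)
  next
    case False
    then have p: "0 < p $ i" for i
      using nn[of i] by (metis less_eq_real_def)
    have x: "0 < (\<chi> i. p $ i / a $ i) $ i" for i
      using a p by simp
    have pM: "0 < (p v* rev_matrix a M) $ j" for j
      unfolding rev_matrix_density[OF a] by (intro mult_pos_pos a matrix_vector_mult_pos M x)
    \<comment> \<open>The factor \<open>a $ j\<close> cancels, so the density of the image is M
      applied to the density of p.\<close>
    have "(\<chi> j. (p v* rev_matrix a M) $ j / a $ j) = M *v (\<chi> i. p $ i / a $ i)"
      unfolding rev_matrix_density[OF a] vec_eq_iff using a by (simp add: less_imp_neq[symmetric])
    then have "sym_entropy a (p v* rev_matrix a M) = ereal (jeffreys_avg a (M *v (\<chi> i. p $ i / a $ i)))"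
      using sym_entropy_jeffreys_avg[OF a pM] by simp
    then show ?thesis
      using False jeffreys_avg_density_pos[OF a p ne]
      by (simp add: contraction_ratio_def sym_entropy_jeffreys_avg[OF a p])
  qed
qed

text \<open>The upper bound is the data-processing inequality divided by a positive L(p). Together
  the bounds confine the supremum over a nonempty set to [0, 1].\<close>

lemma contraction_ratio_bounds:
  fixes a :: "real ^ 'q::finite"
  assumes a: "\<And>i. 0 < a $ i" and M: "M \<in> pos_stochastic_matrices a" and p: "p \<in> prob_simplex - {a}"
  shows "0 \<le> contraction_ratio a p M" and "contraction_ratio a p M \<le> 1"
proof -
  have "0 \<le> contraction_ratio a p M \<and> contraction_ratio a p M \<le> 1"
  proof (cases "\<exists>i. p $ i = 0")
    case False
    then have pp: "0 < p $ i" for i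
      using p by (auto simp: prob_simplex_def less_le)
    have x: "0 < (\<chi> i. p $ i / a $ i) $ i" for i
      using a pp by simp
    have Mp: "0 < M $ i $ j" for i j
      using M by (simp add: pos_stochastic_matrices_def)
    show ?thesis
      using False p jeffreys_avg_matrix_vector_mult_le[OF a M x] jeffreys_avg_density_pos[OF a pp]
        jeffreys_avg_nonneg[OF a matrix_vector_mult_pos[of M, OF Mp x]]
      by (simp add: contraction_ratio_def)
  qed (simp add: contraction_ratio_def)
  then show "0 \<le> contraction_ratio a p M" and "contraction_ratio a p M \<le> 1" by auto
qed

section \<open>Convexity of the matrix set and of the ratio as a function of the matrix\<close>

lemma convex_prob_simplex: "convex prob_simplex"
  by (auto simp: convex_def prob_simplex_def sum.distrib simp flip: sum_distrib_left)

lemma convex_pos_stochastic_matrices: "convex (pos_stochastic_matrices a)"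
proof (rule convexI)
  fix M N :: "real ^ 'a ^ 'a" and u v :: real
  assume M: "M \<in> pos_stochastic_matrices a" and N: "N \<in> pos_stochastic_matrices a"
    and uv: "0 \<le> u" "0 \<le> v" "u + v = 1"
  have "u *\<^sub>R M $ i + v *\<^sub>R N $ i \<in> prob_simplex" for i
    using convexD[OF convex_prob_simplex _ _ uv] M N by (auto simp: pos_stochastic_matrices_def)
  \<comment> \<open>Convexity of the open half-line also covers the case where one weight is
    0.\<close>
  moreover have "0 < u * M $ i $ j + v * N $ i $ j" for i j
    using convexD[of "{0<..}" "M $ i $ j" "N $ i $ j" u v] M N uv
    by (auto simp: pos_stochastic_matrices_def)
  moreover have "a v* (u *\<^sub>R M + v *\<^sub>R N) = u *\<^sub>R (a v* M) + v *\<^sub>R (a v* N)"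
    by (simp add: vec_eq_iff vector_matrix_mult_def sum_distrib_left sum.distrib algebra_simps)
  moreover have "u *\<^sub>R (a v* M) + v *\<^sub>R (a v* N) = a"
    using M N uv by (simp add: pos_stochastic_matrices_def flip: scaleR_add_left)
  ultimately show "u *\<^sub>R M + v *\<^sub>R N \<in> pos_stochastic_matrices a"
    by (simp add: pos_stochastic_matrices_def)
qed

lemma convex_on_contraction_ratio:
  fixes a :: "real ^ 'q::finite"
  assumes a: "\<And>i. 0 < a $ i" and p: "p \<in> prob_simplex - {a}"
  shows "convex_on (pos_stochastic_matrices a) (contraction_ratio a p)"
proof (cases "\<exists>i. p $ i = 0")
  case True
  then show ?thesis
    by (intro convex_onI convex_pos_stochastic_matrices) (simp add: contraction_ratio_def)
next
  case False
  then have pp: "0 < p $ i" for i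
    using p by (auto simp: prob_simplex_def less_le)
  define x where "x = (\<chi> i. p $ i / a $ i)"
  have x: "0 < x $ i" for i
    using a pp by (simp add: x_def)
  \<comment> \<open>The denominator is positive and independent of M, so only the numerator has to
    be shown convex.\<close>
  have L: "0 < jeffreys_avg a x"
    using jeffreys_avg_density_pos[OF a pp] p by (simp add: x_def)
  have r: "contraction_ratio a p M = jeffreys_avg a (M *v x) / jeffreys_avg a x" for M
    using False by (simp add: contraction_ratio_def x_def)
  show ?thesis
  proof (rule convex_onI[OF _ convex_pos_stochastic_matrices])
    fix t :: real and M N :: "real ^ 'q ^ 'q"
    assume t: "0 < t" "t < 1"
      and M: "M \<in> pos_stochastic_matrices a" and N: "N \<in> pos_stochastic_matrices a"
    have "0 < (M *v x) $ i" "0 < (N *v x) $ i" for i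
      using M N x by (auto intro!: matrix_vector_mult_pos simp: pos_stochastic_matrices_def)
    \<comment> \<open>Linearity in M carries the convexity of \<open>jeffreys_avg\<close> over to
      the numerator.\<close>
    moreover have "((1 - t) *\<^sub>R M + t *\<^sub>R N) *v x = (1 - t) *\<^sub>R (M *v x) + t *\<^sub>R (N *v x)"
      by (simp add: matrix_vector_mult_add_rdistrib scaleR_matrix_vector_assoc)
    ultimately have "jeffreys_avg a (((1 - t) *\<^sub>R M + t *\<^sub>R N) *v x)
        \<le> (1 - t) * jeffreys_avg a (M *v x) + t * jeffreys_avg a (N *v x)"
      using convex_onD[OF convex_on_jeffreys_avg[OF a], of t "M *v x" "N *v x"] t by simp
    then have "jeffreys_avg a (((1 - t) *\<^sub>R M + t *\<^sub>R N) *v x) / jeffreys_avg a x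
        \<le> ((1 - t) * jeffreys_avg a (M *v x) + t * jeffreys_avg a (N *v x)) / jeffreys_avg a x"
      using L by (intro divide_right_mono) auto
    then show "contraction_ratio a p ((1 - t) *\<^sub>R M + t *\<^sub>R N)
        \<le> (1 - t) * contraction_ratio a p M + t * contraction_ratio a p N"
      unfolding r by (simp only: add_divide_distrib times_divide_eq_right)
  qed
qed

section \<open>Suprema and strict sublevel sets of convex functions\<close>

lemma convex_on_SUP:
  fixes f :: "'i \<Rightarrow> 'a::real_vector \<Rightarrow> real"
  assumes I: "I \<noteq> {}" and f: "\<And>i. i \<in> I \<Longrightarrow> convex_on S (f i)"
    and bdd: "\<And>x. x \<in> S \<Longrightarrow> bdd_above ((\<lambda>i. f i x) ` I)"
  shows "convex_on S (\<lambda>x. SUP i\<in>I. f i x)"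
proof (rule convex_onI)
  show "convex S" using I f by (auto simp: convex_on_def)
next
  fix t :: real and x y assume t: "0 < t" "t < 1" and x: "x \<in> S" and y: "y \<in> S"
  show "(SUP i\<in>I. f i ((1 - t) *\<^sub>R x + t *\<^sub>R y)) \<le> (1 - t) * (SUP i\<in>I. f i x) + t * (SUP i\<in>I. f i y)"
  proof (rule cSUP_least[OF I])
    fix i assume i: "i \<in> I"
    have "f i ((1 - t) *\<^sub>R x + t *\<^sub>R y) \<le> (1 - t) * f i x + t * f i y"
      using convex_onD[OF f[OF i], of t x y] t x y by simp
    \<comment> \<open>Boundedness at x and at y is what places each value below its real
      supremum.\<close>
    also have "\<dots> \<le> (1 - t) * (SUP i\<in>I. f i x) + t * (SUP i\<in>I. f i y)"
      using t by (intro add_mono mult_left_mono cSUP_upper i bdd x y) auto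
    finally show "f i ((1 - t) *\<^sub>R x + t *\<^sub>R y) \<le> (1 - t) * (SUP i\<in>I. f i x) + t * (SUP i\<in>I. f i y)" .
  qed
qed

lemma convex_strict_sublevel:
  assumes "convex_on S f"
  shows "convex {x \<in> S. f x < c}"
proof (rule convexI)
  fix x y and u v :: real
  assume x: "x \<in> {x \<in> S. f x < c}" and y: "y \<in> {x \<in> S. f x < c}"
    and uv: "0 \<le> u" "0 \<le> v" "u + v = 1"
  have "f (u *\<^sub>R x + v *\<^sub>R y) \<le> u * f x + v * f y"
    using assms x y uv by (auto simp: convex_on_def)
  \<comment> \<open>The inequality stays strict when a weight is 0, since the open half-line is
    convex.\<close>
  also have "\<dots> < c"
    using convexD[of "{..<c}" "f x" "f y" u v] x y uv by simp
  finally show "u *\<^sub>R x + v *\<^sub>R y \<in> {x \<in> S. f x < c}"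
    using assms x y uv by (auto simp: convex_on_def convex_def)
qed

text \<open>Two distinct vertices of the simplex exist, and at most one of them equals
  \<open>a\<close>.\<close>

lemma prob_simplex_minus_singleton_nonempty:
  assumes "CARD('q::finite) \<ge> 2"
  shows "prob_simplex - {a :: real ^ 'q} \<noteq> {}"
proof -
  have "\<not> card (UNIV :: 'q set) \<le> Suc 0"
    using assms by simp
  then obtain i j :: 'q where "i \<noteq> j"
    by (subst (asm) card_le_Suc0_iff_eq) auto
  then have "axis i (1::real) \<noteq> axis j 1"
    by (simp add: axis_eq_axis)
  then obtain k where "axis k (1::real) \<noteq> a"
    by metis
  moreover have "axis k (1::real) \<in> prob_simplex"
    by (simp add: prob_simplex_def axis_def)
  ultimately show ?thesis by blast
qed

theorem mainTheorem3:
  fixes \<alpha> :: "real ^ 'q::finite"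
  assumes "CARD('q) \<ge> 2"
    and "\<alpha> \<in> prob_simplex"
  shows "(\<forall>M\<in>pos_stochastic_matrices \<alpha>. \<bar>contraction_coeff \<alpha> M\<bar> \<noteq> \<infinity>)
    \<and> convex_on (pos_stochastic_matrices \<alpha>) (\<lambda>M. real_of_ereal (contraction_coeff \<alpha> M))
    \<and> (\<forall>d::nat. d \<ge> 1 \<longrightarrow>
        convex {M \<in> pos_stochastic_matrices \<alpha>. ereal (real d) * contraction_coeff \<alpha> M < 1})"
\<comment> \<open>A zero entry of \<alpha> forces the empty case, where every claim is trivial.
  Otherwise any matrix of the set witnesses that \<alpha> is positive.\<close>
proof (cases "pos_stochastic_matrices \<alpha> = {}")
  case True
  then show ?thesis by (simp add: convex_on_def)
next
  case False
  then have a: "0 < \<alpha> $ i" for i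
    using pos_stochastic_matrices_stationary_pos[OF assms(2)] by blast
  define c where "c M = (SUP p\<in>prob_simplex - {\<alpha>}. contraction_ratio \<alpha> p M)" for M
  note ne = prob_simplex_minus_singleton_nonempty[OF assms(1), of \<alpha>]
  have bdd: "bdd_above ((\<lambda>p. contraction_ratio \<alpha> p M) ` (prob_simplex - {\<alpha>}))"
    if "M \<in> pos_stochastic_matrices \<alpha>" for M
    using contraction_ratio_bounds(2)[OF a that] by (intro bdd_aboveI2)
  have coeff: "contraction_coeff \<alpha> M = ereal (c M)" if M: "M \<in> pos_stochastic_matrices \<alpha>" for M
  proof -
    have "ereal (contraction_ratio \<alpha> p M) \<le> 1" if "p \<in> prob_simplex - {\<alpha>}" for p
      using contraction_ratio_bounds(2)[OF a M that] by simp
    then have le: "(SUP p\<in>prob_simplex - {\<alpha>}. ereal (contraction_ratio \<alpha> p M)) \<le> 1"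
      by (rule SUP_least)
    obtain p where p: "p \<in> prob_simplex - {\<alpha>}"
      using ne by blast
    have "0 \<le> (SUP p\<in>prob_simplex - {\<alpha>}. ereal (contraction_ratio \<alpha> p M))"
      using contraction_ratio_bounds(1)[OF a M p] by (intro SUP_upper2[OF p]) simp
    \<comment> \<open>Real and extended suprema agree once the latter is finite, which the bounds 0
      and 1 ensure.\<close>
    then have "ereal (c M) = (SUP p\<in>prob_simplex - {\<alpha>}. ereal (contraction_ratio \<alpha> p M))"
      unfolding c_def using le by (intro ereal_SUP) auto
    then show ?thesis
      using contraction_coeff_SUP[of \<alpha> M, OF a] M by (simp add: pos_stochastic_matrices_def)
  qed
  have c: "convex_on (pos_stochastic_matrices \<alpha>) c"
    unfolding c_def by (rule convex_on_SUP[OF ne convex_on_contraction_ratio[OF a] bdd])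
  have "convex {M \<in> pos_stochastic_matrices \<alpha>. ereal (real d) * contraction_coeff \<alpha> M < 1}" for d
  proof -
    \<comment> \<open>With finite coefficients this is a strict sublevel set of the real convex
      function d c(M).\<close>
    have "{M \<in> pos_stochastic_matrices \<alpha>. ereal (real d) * contraction_coeff \<alpha> M < 1}
        = {M \<in> pos_stochastic_matrices \<alpha>. real d * c M < 1}"
      by (auto simp: coeff)
    then show ?thesis
      using convex_strict_sublevel[OF convex_on_cmul[OF _ c, of "real d"], of 1] by simp
  qed
  \<comment> \<open>\<open>coeff\<close> holds only on the set, so its convexity is needed to
    rewrite the value at a convex combination.\<close>
  moreover have "convex_on (pos_stochastic_matrices \<alpha>) (\<lambda>M. real_of_ereal (contraction_coeff \<alpha> M))"
    using c coeff unfolding convex_on_def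
    by (auto simp: convexD[OF convex_pos_stochastic_matrices])
  ultimately show ?thesis
    by (simp add: coeff)
qed

end
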